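(* Let $U$ be a bounded and open subset of $\mathbb{R}^n$ and let $\mathbf{w}$ be an arbitrary point in $U$. If $U$ is convex, then each ray emanating from the point $\mathbf{w}$ intersects the boundary of $U$ at a single point. The converse is also true: if each ray emanating from the point $\mathbf{w}$ intersects the boundary of $U$ at a single point, then $U$ is convex.
   Context: A ray emanating from a point $\mathbf{w}\in\mathbb{R}^n$ is the set of all points of the form $\mathbf{w}+t\mathbf{p}$, where $\mathbf{p}$ is a fixed point of $\mathbb{R}^n\setminus\{\mathbf{0}\}$ and $t$ ranges over the non-negative reals. A subset $U$ of $\mathbb{R}^n$ is convex if for each pair $\mathbf{x},\mathbf{y}$ of points of $U$ the line segment joining them lies in $U$, that is, $(1-t)\mathbf{x}+t\mathbf{y}\in U$ for all $t\in[0,1]$. The boundary of $U$ is its topological boundary in $\mathbb{R}^n$.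
   Formalization: In the converse, the condition that each ray emanating from w meets the boundary at a single point is assumed for every point w of U, not for one fixed w; for one fixed w the converse fails, e.g. for a non-convex star-shaped planar region seen from its centre. *)

theory Defs imports "HOL-Analysis.Analysis" begin

definition rays_from :: "'a::real_vector \<Rightarrow> 'a set set" where
  "rays_from w = {{w + t *\<^sub>R p |t. 0 \<le> t} |p. p \<noteq> 0}"

end

theory Submission imports Defs begin

text \<open>
  If \<open>U\<close> is convex, the half-open segment from a point of \<open>U\<close> to a point of its closure lies in the
  interior, so of two frontier points on a ray the nearer one would be interior. Conversely, let
  \<open>x, y \<in> U\<close>. The frontier point of the ray from \<open>y\<close> in direction \<open>y - x\<close> is also the only frontier
  point of the ray from \<open>x\<close> through \<open>y\<close>. It lies beyond \<open>y\<close>, and the latter ray stays in \<open>U\<close> until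
  its first frontier point, so the segment from \<open>x\<close> to \<open>y\<close> lies in \<open>U\<close>.
\<close>

text \<open>Phrased with parameters instead of points, so that two frontier points can be ordered
  along the ray.\<close>

lemma convex_imp_ray_frontier_unique:
  fixes U :: "'a::euclidean_space set"
  assumes "convex U" "open U" "w \<in> U" "p \<noteq> 0" "0 \<le> s" "0 \<le> t"
    and "w + s *\<^sub>R p \<in> frontier U" "w + t *\<^sub>R p \<in> frontier U"
  shows "s = t"
proof -
  have False if "0 \<le> a" "a < b" "w + a *\<^sub>R p \<in> frontier U" "w + b *\<^sub>R p \<in> frontier U" for a b
  proof -
    \<comment> \<open>The weight \<open>a / b\<close> used below must lie strictly between 0 and 1,
      so \<open>a = 0\<close> is excluded first.\<close>
    have "w \<notin> frontier U"
      using assms by (simp add: frontier_def interior_open)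
    with that have "a \<noteq> 0" by auto
    then have "w + a *\<^sub>R p \<in> open_segment w (w + b *\<^sub>R p)"
      using that \<open>p \<noteq> 0\<close> unfolding in_segment
      by (auto intro!: exI[of _ "a / b"] simp: algebra_simps)
    moreover have "open_segment w (w + b *\<^sub>R p) \<subseteq> interior U"
      using assms that by (intro in_interior_closure_convex_segment) (auto simp: interior_open frontier_def)
    ultimately show False
      using that by (auto simp: frontier_def)
  qed
  then show ?thesis
    using assms by (metis linorder_neqE_linordered_idom)
qed

lemma convex_imp_ray_meets_frontier_once:
  fixes U :: "'a::euclidean_space set"
  assumes "bounded U" "open U" "convex U" "w \<in> U" "R \<in> rays_from w"
  shows "\<exists>!x. x \<in> R \<inter> frontier U"
proof -
  obtain p where p: "p \<noteq> 0" and R: "R = {w + t *\<^sub>R p |t. 0 \<le> t}"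
    using assms by (auto simp: rays_from_def)
  \<comment> \<open>Existence: a bounded set cannot contain a whole ray.\<close>
  obtain d where "0 < d" "w + d *\<^sub>R p \<in> frontier U"
    using ray_to_frontier[of U w p] assms p by (auto simp: interior_open)
  then have "w + d *\<^sub>R p \<in> R \<inter> frontier U"
    by (auto simp: R intro!: exI[of _ d])
  moreover have "x = y" if "x \<in> R \<inter> frontier U" "y \<in> R \<inter> frontier U" for x y
    using that convex_imp_ray_frontier_unique[OF \<open>convex U\<close> \<open>open U\<close> \<open>w \<in> U\<close> p] unfolding R by blast
  ultimately show ?thesis by blast
qed

text \<open>Uniqueness is applied at the endpoint \<open>x\<close> of an arbitrary segment, hence
  assumed at every point of \<open>U\<close>; for a single \<open>w\<close> the argument only makes
  \<open>U\<close> star-shaped about \<open>w\<close>.\<close>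

lemma rays_meet_frontier_once_imp_convex:
  fixes U :: "'a::euclidean_space set"
  assumes "bounded U" "open U"
    and once: "\<And>w R. w \<in> U \<Longrightarrow> R \<in> rays_from w \<Longrightarrow> \<exists>!x. x \<in> R \<inter> frontier U"
  shows "convex U"
  unfolding convex_alt
proof (intro ballI allI impI)
  fix x y and u :: real
  assume x: "x \<in> U" and y: "y \<in> U" and u: "0 \<le> u \<and> u \<le> 1"
  show "(1 - u) *\<^sub>R x + u *\<^sub>R y \<in> U"
  proof (cases "x = y")
    case True
    then show ?thesis using x by (simp add: algebra_simps)
  next
    case False
    define p where "p = y - x"
    have p: "p \<noteq> 0" using False by (simp add: p_def)
    obtain d where d: "0 < d" "x + d *\<^sub>R p \<in> frontier U"
      and before: "\<And>e. 0 \<le> e \<Longrightarrow> e < d \<Longrightarrow> x + e *\<^sub>R p \<in> interior U"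
      using ray_to_frontier[of U x p] assms x p by (auto simp: interior_open)
    obtain e where e: "0 < e" "y + e *\<^sub>R p \<in> frontier U"
      using ray_to_frontier[of U y p] assms(1,2) y p by (metis interior_open)
    let ?R = "{x + t *\<^sub>R p |t. 0 \<le> t}"
    have "?R \<in> rays_from x"
      using p unfolding rays_from_def by blast
    moreover have "x + d *\<^sub>R p \<in> ?R"
      using d by (auto intro!: exI[of _ d])
    \<comment> \<open>Since \<open>y = x + p\<close>, passing from base point \<open>y\<close> to
      \<open>x\<close> shifts the parameter by 1.\<close>
    moreover have "y + e *\<^sub>R p = x + (1 + e) *\<^sub>R p"
      by (simp add: p_def algebra_simps)
    moreover from this have "y + e *\<^sub>R p \<in> ?R"
      using e by (auto intro!: exI[of _ "1 + e"])
    ultimately have "x + d *\<^sub>R p = x + (1 + e) *\<^sub>R p"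
      using once[OF x] d e by (metis (no_types, lifting) IntI)
    then have "d = 1 + e" using p by (simp only: add_left_cancel scaleR_cancel_right) simp
    \<comment> \<open>Here \<open>u \<le> 1 < 1 + e = d\<close>, so the ray has not yet left
      \<open>U\<close>.\<close>
    then have "x + u *\<^sub>R p \<in> interior U"
      using u e by (intro before) auto
    then show ?thesis
      using \<open>open U\<close> by (simp add: interior_open p_def algebra_simps)
  qed
qed

theorem lemma3p21:
  fixes U :: "(real ^ 'n) set"
  assumes "bounded U" and "open U"
  shows "(convex U \<longrightarrow> (\<forall>w\<in>U. \<forall>R\<in>rays_from w. \<exists>!x. x \<in> R \<inter> frontier U)) \<and>
         ((\<forall>w\<in>U. \<forall>R\<in>rays_from w. \<exists>!x. x \<in> R \<inter> frontier U) \<longrightarrow> convex U)"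
  using convex_imp_ray_meets_frontier_once[OF assms] rays_meet_frontier_once_imp_convex[OF assms]
  by blast

end
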